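(* Let $S$ be an inverse semigroup with zero and with set of idempotents $E$. There is a bijection $\epsilon\colon\mathscr{F}^{(0)}\to\mathsf{F}(E)$ from the set of idempotent proper filters in $S$ to the set of proper filters in $E$, given by $\epsilon(F)=F\cap E$, with inverse given by $\epsilon^{-1}(\xi)=\xi^\uparrow$ (upward closure in $S$). Moreover, $\epsilon$ is a homeomorphism of Hausdorff spaces with respect to the patch topology, and the restriction $\epsilon|_{\mathscr{U}^{(0)}}$ to the set of idempotent ultrafilters is a homeomorphism onto $\mathsf{U}(E)$.
   Context: $S$ is an inverse semigroup (each $a\in S$ has a unique $a^*$ with $aa^*a=a$, $a^*aa^*=a^*$) containing $0$ with $0a=a0=0$ for all $a$. Its natural partial order is $a\le b \iff a=aa^*b$. $E=\{e\in S: ee=e\}$ is the set of idempotents, itself a commutative inverse semigroup containing $0$. For $A\subseteq S$, $A^\uparrow=\{b\in S: a\le b\text{ for some }a\in A\}$; $s^\downarrow=\{b\in S: b\le s\}$. A filter in $S$ is a nonempty subset $F$ with $F^\uparrow=F$ that is down-directed (for $a,b\in F$ there is $c\in F$ with $c\le a,b$). It is proper if $0\notin F$; an ultrafilter is a maximal proper filter; it is idempotent if $F\cap E\ne\varnothing$. $\mathscr{F}$ and $\mathscr{U}$ are the sets of proper filters and of ultrafilters in $S$; $\mathscr{F}^{(0)}$ and $\mathscr{U}^{(0)}$ are the subsets of those that are idempotent. The patch topology on $\mathscr{F}$ has basis $\mathscr{F}_{s:T}=\{F\in\mathscr{F}: s\in F\subseteq S\setminus T\}$, for $s\in S$ and finite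 $T\subseteq s^\downarrow$; $\mathscr{F}^{(0)}$ and $\mathscr{U}^{(0)}$ carry the subspace topologies. $\mathsf{F}(E)$ and $\mathsf{U}(E)$ are the sets of proper filters and of ultrafilters in the inverse semigroup $E$. The patch topology on $\mathsf{F}(E)$ has basis $\mathsf{F}_{e:X}=\{\xi\in\mathsf{F}(E): e\in\xi\subseteq E\setminus X\}$, for $e\in E$ and finite $X\subseteq e^\downarrow$; $\mathsf{U}(E)$ carries the subspace topology. *)

theory Defs
  imports "HOL-Analysis.Analysis" "HOL-Algebra.Congruence"
begin

record 'a semigroup_zero = "'a partial_object" +
  mult :: "'a \<Rightarrow> 'a \<Rightarrow> 'a" (infixl \<open>\<cdot>\<index>\<close> 70)
  zero_elt :: 'a (\<open>\<zero>\<index>\<close>)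

locale inverse_semigroup_zero =
  fixes S (structure)
  assumes mult_closed: "\<lbrakk>a \<in> carrier S; b \<in> carrier S\<rbrakk> \<Longrightarrow> a \<cdot> b \<in> carrier S"
    and mult_assoc: "\<lbrakk>a \<in> carrier S; b \<in> carrier S; c \<in> carrier S\<rbrakk>
      \<Longrightarrow> (a \<cdot> b) \<cdot> c = a \<cdot> (b \<cdot> c)"
    and ex1_star: "a \<in> carrier S \<Longrightarrow> \<exists>!b. b \<in> carrier S \<and> a \<cdot> b \<cdot> a = a \<and> b \<cdot> a \<cdot> b = b"
    and zero_closed: "\<zero> \<in> carrier S"
    and zero_left: "a \<in> carrier S \<Longrightarrow> \<zero> \<cdot> a = \<zero>"
    and zero_right: "a \<in> carrier S \<Longrightarrow> a \<cdot> \<zero> = \<zero>"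

definition star :: "('a, 'm) semigroup_zero_scheme \<Rightarrow> 'a \<Rightarrow> 'a" where
  "star S a = (THE b. b \<in> carrier S \<and> a \<cdot>\<^bsub>S\<^esub> b \<cdot>\<^bsub>S\<^esub> a = a \<and> b \<cdot>\<^bsub>S\<^esub> a \<cdot>\<^bsub>S\<^esub> b = b)"

definition nat_le :: "('a, 'm) semigroup_zero_scheme \<Rightarrow> 'a \<Rightarrow> 'a \<Rightarrow> bool" where
  "nat_le S a b \<longleftrightarrow> a = a \<cdot>\<^bsub>S\<^esub> star S a \<cdot>\<^bsub>S\<^esub> b"

definition idempotents :: "('a, 'm) semigroup_zero_scheme \<Rightarrow> 'a set" where
  "idempotents S = {e \<in> carrier S. e \<cdot>\<^bsub>S\<^esub> e = e}"

(* E regarded as an inverse semigroup in its own right. The order, filters and topology below,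
   when applied to it, are computed inside E. *)
definition idempotent_semigroup ::
    "('a, 'm) semigroup_zero_scheme \<Rightarrow> ('a, 'm) semigroup_zero_scheme" where
  "idempotent_semigroup S = S\<lparr>carrier := idempotents S\<rparr>"

definition up_closure :: "('a, 'm) semigroup_zero_scheme \<Rightarrow> 'a set \<Rightarrow> 'a set" where
  "up_closure S A = {b \<in> carrier S. \<exists>a\<in>A. nat_le S a b}"

definition down_set :: "('a, 'm) semigroup_zero_scheme \<Rightarrow> 'a \<Rightarrow> 'a set" where
  "down_set S s = {b \<in> carrier S. nat_le S b s}"

definition is_filter :: "('a, 'm) semigroup_zero_scheme \<Rightarrow> 'a set \<Rightarrow> bool" where
  "is_filter S F \<longleftrightarrow> F \<subseteq> carrier S \<and> F \<noteq> {} \<and> up_closure S F = F \<and>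
    (\<forall>a\<in>F. \<forall>b\<in>F. \<exists>c\<in>F. nat_le S c a \<and> nat_le S c b)"

definition proper_filters :: "('a, 'm) semigroup_zero_scheme \<Rightarrow> 'a set set" where
  "proper_filters S = {F. is_filter S F \<and> \<zero>\<^bsub>S\<^esub> \<notin> F}"

definition ultrafilters :: "('a, 'm) semigroup_zero_scheme \<Rightarrow> 'a set set" where
  "ultrafilters S = {F \<in> proper_filters S. \<forall>G\<in>proper_filters S. F \<subseteq> G \<longrightarrow> G = F}"

definition idempotent_proper_filters :: "('a, 'm) semigroup_zero_scheme \<Rightarrow> 'a set set" where
  "idempotent_proper_filters S = {F \<in> proper_filters S. F \<inter> idempotents S \<noteq> {}}"

definition idempotent_ultrafilters :: "('a, 'm) semigroup_zero_scheme \<Rightarrow> 'a set set" where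
  "idempotent_ultrafilters S = {F \<in> ultrafilters S. F \<inter> idempotents S \<noteq> {}}"

definition basic_patch ::
    "('a, 'm) semigroup_zero_scheme \<Rightarrow> 'a \<Rightarrow> 'a set \<Rightarrow> 'a set set" where
  "basic_patch S s T = {F \<in> proper_filters S. s \<in> F \<and> F \<subseteq> carrier S - T}"

(* In an inverse semigroup with zero the generating sets are closed under enough intersections
   to form a basis: if F contains s and t, pick r in F below both; then for x below s (or t),
   a filter containing r contains x iff it contains r r* x, which lies below r. *)
definition patch_topology :: "('a, 'm) semigroup_zero_scheme \<Rightarrow> 'a set topology" where
  "patch_topology S = topology_generated_by
     {basic_patch S s T |s T. s \<in> carrier S \<and> finite T \<and> T \<subseteq> down_set S s}"

lemma topspace_patch_topology: "topspace (patch_topology S) = proper_filters S"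
proof -
  have "F \<in> \<Union>{basic_patch S s T |s T. s \<in> carrier S \<and> finite T \<and> T \<subseteq> down_set S s}"
    if F: "F \<in> proper_filters S" for F
  proof -
    obtain s where "s \<in> F" "F \<subseteq> carrier S"
      using F by (auto simp: proper_filters_def is_filter_def)
    then have "F \<in> basic_patch S s {}" "s \<in> carrier S" "{} \<subseteq> down_set S s"
      using F by (auto simp: basic_patch_def)
    then show ?thesis by blast
  qed
  then show ?thesis
    unfolding patch_topology_def topology_generated_by_topspace
    by (auto simp: basic_patch_def)
qed

end

theory Submission
  imports Defs
begin

text \<open>
  An idempotent filter is generated by its idempotents: below any element and any idempotent of
  the filter lies a further member, which is again idempotent. This gives the bijection, and
  since both directions preserve inclusion, ultrafilters correspond. A filter
  \<open>\<xi>\<close> of idempotents that contains \<open>e \<le> s\<close> satisfies, for \<open>t \<le> s\<close>, the equivalence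
  \<open>t \<in> \<xi>\<^sup>\<up> \<longleftrightarrow> e t \<in> \<xi>\<close>, where \<open>e t \<le> e\<close> is idempotent; hence the inverse map is continuous.
  Distinct filters \<open>\<xi> \<ni> e\<close> and \<open>\<eta> \<ni> f\<close> with \<open>e \<notin> \<eta>\<close> are separated by the conditions
  ``contains \<open>e\<close>'' and ``contains \<open>f\<close> but not \<open>e f\<close>''.
\<close>

context inverse_semigroup_zero
begin

section \<open>Inverse semigroups: inverses and products of idempotents\<close>

abbreviation E :: "'a set" where "E \<equiv> idempotents S"

abbreviation le :: "'a \<Rightarrow> 'a \<Rightarrow> bool" (infix \<open>\<preceq>\<close> 50) where "a \<preceq> b \<equiv> nat_le S a b"

lemmas mult_simps = mult_closed mult_assoc

lemma star_props:
  assumes "a \<in> carrier S"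
  shows star_closed: "star S a \<in> carrier S"
    and mult_star_mult: "a \<cdot> star S a \<cdot> a = a"
    and star_mult_star: "star S a \<cdot> a \<cdot> star S a = star S a"
  using theI'[OF ex1_star[OF assms]] unfolding star_def by auto

lemma star_unique:
  assumes "a \<in> carrier S" "b \<in> carrier S" "a \<cdot> b \<cdot> a = a" "b \<cdot> a \<cdot> b = b"
  shows "star S a = b"
  using the1_equality[OF ex1_star[OF assms(1)]] assms(2-4) unfolding star_def by blast

lemma idempotentsD:
  assumes "e \<in> E"
  shows idempotent_closed: "e \<in> carrier S" and idempotent_mult: "e \<cdot> e = e"
  using assms by (auto simp: idempotents_def)

lemma star_idempotent: "e \<in> E \<Longrightarrow> star S e = e"
  by (rule star_unique) (auto simp: idempotentsD)

lemma mult_star_idempotent: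
  assumes "a \<in> carrier S"
  shows "a \<cdot> star S a \<in> E"
  using star_props[OF assms] assms
  by (simp add: idempotents_def mult_closed flip: mult_assoc)

text \<open>If \<open>x\<close> is the inverse of \<open>e f\<close>, then \<open>f x e\<close> is
  an inverse of \<open>e f\<close> as well, so uniqueness gives \<open>x = f x e\<close>, and this
  element is visibly idempotent. Now \<open>e f\<close> is the inverse of \<open>x\<close>, while an
  idempotent is its own inverse; hence \<open>e f = x\<close>.\<close>

lemma idempotents_mult_closed:
  assumes e: "e \<in> E" and f: "f \<in> E"
  shows "e \<cdot> f \<in> E"
proof -
  note c = idempotentsD[OF e] idempotentsD[OF f]
  define x where "x = star S (e \<cdot> f)"
  have ef: "e \<cdot> f \<in> carrier S" using c by (simp add: mult_closed)
  have x: "x \<in> carrier S" "e \<cdot> f \<cdot> x \<cdot> (e \<cdot> f) = e \<cdot> f" "x \<cdot> (e \<cdot> f) \<cdot> x = x"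
    using star_props[OF ef] by (auto simp: x_def)
  \<comment> \<open>The laws for \<open>e e\<close>, \<open>f f\<close> and \<open>x (e f) x\<close>
    are restated with a trailing factor \<open>y\<close>, so that they still fire once
    \<open>mult_assoc\<close> has bracketed every product to the right.\<close>
  have e2: "e \<cdot> (e \<cdot> y) = e \<cdot> y" "f \<cdot> (f \<cdot> y) = f \<cdot> y" if "y \<in> carrier S" for y
    using c that by (simp_all flip: mult_assoc)
  have x3: "x \<cdot> (e \<cdot> (f \<cdot> (x \<cdot> y))) = x \<cdot> y" if "y \<in> carrier S" for y
    using arg_cong[OF x(3), of "\<lambda>z. z \<cdot> y"] that x(1) c by (simp add: mult_simps)
  have "x = f \<cdot> x \<cdot> e"
    unfolding x_def
  proof (rule star_unique, fold x_def)
    show "e \<cdot> f \<cdot> (f \<cdot> x \<cdot> e) \<cdot> (e \<cdot> f) = e \<cdot> f"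
      using x c by (simp add: mult_simps e2)
    show "f \<cdot> x \<cdot> e \<cdot> (e \<cdot> f) \<cdot> (f \<cdot> x \<cdot> e) = f \<cdot> x \<cdot> e"
      using x(1) c by (simp add: mult_simps e2 x3)
  qed (use x c in \<open>simp_all add: mult_closed\<close>)
  moreover have "(f \<cdot> x \<cdot> e) \<cdot> (f \<cdot> x \<cdot> e) = f \<cdot> x \<cdot> e"
    using x(1) c by (simp add: mult_simps e2 x3)
  ultimately have xE: "x \<in> E"
    using x(1) by (simp add: idempotents_def)
  have "star S x = e \<cdot> f"
    by (rule star_unique) (use x ef in auto)
  then show ?thesis using star_idempotent[OF xE] xE by simp
qed

text \<open>Both products are idempotent, and \<open>f e\<close> is an inverse of
  \<open>e f\<close>. As an idempotent, \<open>e f\<close> is also its own inverse, so uniqueness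
  identifies the two.\<close>

lemma idempotents_commute:
  assumes e: "e \<in> E" and f: "f \<in> E"
  shows "e \<cdot> f = f \<cdot> e"
proof -
  note c = idempotentsD[OF e] idempotentsD[OF f]
  have e2: "e \<cdot> (e \<cdot> y) = e \<cdot> y" "f \<cdot> (f \<cdot> y) = f \<cdot> y" if "y \<in> carrier S" for y
    using c that by (simp_all flip: mult_assoc)
  have ef: "e \<cdot> f \<in> E" "f \<cdot> e \<in> E"
    using e f by (simp_all add: idempotents_mult_closed)
  have "star S (e \<cdot> f) = f \<cdot> e"
    using idempotentsD[OF ef(1)] idempotentsD[OF ef(2)] c
    by (intro star_unique) (simp_all add: mult_simps e2)
  then show ?thesis using star_idempotent[OF ef(1)] by simp
qed

text \<open>The idempotents \<open>v (star v)\<close> and \<open>(star u) u\<close> commute, which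
  collapses \<open>u v (star v) (star u) u v\<close> to \<open>u v\<close>. Both defining equations
  of the inverse are instances: first for \<open>a\<close>, \<open>b\<close>, then for
  \<open>star b\<close>, \<open>star a\<close>, using that \<open>star\<close> is an
  involution.\<close>

lemma star_mult:
  assumes a: "a \<in> carrier S" and b: "b \<in> carrier S"
  shows "star S (a \<cdot> b) = star S b \<cdot> star S a"
proof -
  have *: "u \<cdot> v \<cdot> (star S v \<cdot> star S u) \<cdot> (u \<cdot> v) = u \<cdot> v"
    if u: "u \<in> carrier S" and v: "v \<in> carrier S" and uE: "star S u \<cdot> u \<in> E" for u v
  proof -
    note c = u v star_closed[OF u] star_closed[OF v]
    have "u \<cdot> v \<cdot> (star S v \<cdot> star S u) \<cdot> (u \<cdot> v)
        = u \<cdot> ((v \<cdot> star S v) \<cdot> (star S u \<cdot> u)) \<cdot> v"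
      using c by (simp add: mult_simps)
    also have "\<dots> = u \<cdot> ((star S u \<cdot> u) \<cdot> (v \<cdot> star S v)) \<cdot> v"
      using idempotents_commute[OF uE mult_star_idempotent[OF v]] by simp
    also have "\<dots> = (u \<cdot> star S u \<cdot> u) \<cdot> (v \<cdot> star S v \<cdot> v)"
      using c by (simp add: mult_simps)
    finally show ?thesis using u v by (simp add: mult_star_mult)
  qed
  have ss: "star S (star S u) = u" if "u \<in> carrier S" for u
    using star_props[OF that] that by (intro star_unique) auto
  have sE: "star S u \<cdot> u \<in> E" if "u \<in> carrier S" for u
    using mult_star_idempotent[OF star_closed[OF that]] ss[OF that] by simp
  note c = a b star_closed[OF a] star_closed[OF b]
  show ?thesis
    using *[OF a b sE[OF a]] *[OF c(4,3) sE[OF c(4)]] c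
    by (intro star_unique) (auto simp: mult_closed ss)
qed

section \<open>The natural partial order\<close>

lemma le_iff_idempotent_mult:
  assumes a: "a \<in> carrier S" and b: "b \<in> carrier S"
  shows "a \<preceq> b \<longleftrightarrow> (\<exists>e\<in>E. a = e \<cdot> b)"
proof
  assume "a \<preceq> b"
  then show "\<exists>e\<in>E. a = e \<cdot> b"
    using mult_star_idempotent[OF a] by (auto simp: nat_le_def)
next
  assume "\<exists>e\<in>E. a = e \<cdot> b"
  then obtain e where e: "e \<in> E" and ab: "a = e \<cdot> b" by blast
  note c = b star_closed[OF b] idempotentsD[OF e]
  \<comment> \<open>Here \<open>star a = (star b) e\<close>. Moving \<open>e\<close> past the
    idempotent \<open>b (star b)\<close> brings the two copies of \<open>e\<close> together and
    leaves \<open>e b\<close>.\<close>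
  have "a \<cdot> star S a \<cdot> b = e \<cdot> ((b \<cdot> star S b) \<cdot> e) \<cdot> b"
    using c by (simp add: ab star_mult star_idempotent[OF e] mult_simps)
  also have "(b \<cdot> star S b) \<cdot> e = e \<cdot> (b \<cdot> star S b)"
    by (rule idempotents_commute[OF mult_star_idempotent[OF b] e])
  also have "e \<cdot> (e \<cdot> (b \<cdot> star S b)) \<cdot> b = (e \<cdot> e) \<cdot> (b \<cdot> star S b \<cdot> b)"
    using c(1-3) by (simp add: mult_simps)
  finally show "a \<preceq> b"
    using c by (simp add: nat_le_def ab mult_star_mult)
qed

lemma le_refl: "a \<in> carrier S \<Longrightarrow> a \<preceq> a"
  by (simp add: nat_le_def mult_star_mult)

lemma le_trans:
  assumes "a \<preceq> b" "b \<preceq> c" "a \<in> carrier S" "b \<in> carrier S" "c \<in> carrier S"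
  shows "a \<preceq> c"
proof -
  obtain e f where "e \<in> E" "f \<in> E" "a = e \<cdot> b" "b = f \<cdot> c"
    using assms by (auto simp: le_iff_idempotent_mult)
  then show ?thesis
    using assms idempotents_mult_closed[of e f]
    by (auto simp: le_iff_idempotent_mult mult_assoc idempotent_closed intro!: bexI[of _ "e \<cdot> f"])
qed

lemma idempotent_mult_le: "\<lbrakk>e \<in> E; a \<in> carrier S\<rbrakk> \<Longrightarrow> e \<cdot> a \<preceq> a"
  by (auto simp: le_iff_idempotent_mult idempotent_closed mult_closed)

text \<open>The idempotent \<open>f\<close> with \<open>a = f b\<close> commutes with
  \<open>e\<close>, so the same \<open>f\<close> witnesses the new inequality.\<close>

lemma idempotent_mult_mono:
  assumes e: "e \<in> E" and ab: "a \<preceq> b" and a: "a \<in> carrier S" and b: "b \<in> carrier S"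
  shows "e \<cdot> a \<preceq> e \<cdot> b"
proof -
  obtain f where f: "f \<in> E" "a = f \<cdot> b"
    using ab a b by (auto simp: le_iff_idempotent_mult)
  have "e \<cdot> a = f \<cdot> (e \<cdot> b)"
    using e f b idempotents_commute[of e f] by (simp add: idempotent_closed flip: mult_assoc)
  then show ?thesis
    using e f a b by (auto simp: le_iff_idempotent_mult mult_closed idempotent_closed)
qed

lemma idempotent_le_mult: "\<lbrakk>e \<in> E; e \<preceq> s\<rbrakk> \<Longrightarrow> e \<cdot> s = e"
  by (simp add: nat_le_def star_idempotent idempotent_mult)

text \<open>Such an \<open>a\<close> is a product of two idempotents. This is what makes lower
  bounds found inside a filter of \<open>S\<close> available in \<open>E\<close>.\<close>

lemma le_idempotent:
  assumes "a \<preceq> e" "a \<in> carrier S" "e \<in> E"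
  shows "a \<in> E"
  using assms by (auto simp: le_iff_idempotent_mult idempotent_closed idempotents_mult_closed)

lemma le_zero: "\<lbrakk>a \<preceq> \<zero>; a \<in> carrier S\<rbrakk> \<Longrightarrow> a = \<zero>"
  by (simp add: nat_le_def zero_right mult_closed star_closed)

section \<open>The idempotents as an inverse semigroup of their own\<close>

lemma carrier_idempotent_semigroup: "carrier (idempotent_semigroup S) = E"
  by (simp add: idempotent_semigroup_def)

text \<open>In \<open>E\<close> the description operator ranges over a smaller carrier. The inverse
  of \<open>e\<close> in \<open>S\<close> is \<open>e\<close>, which lies in \<open>E\<close>, and
  any inverse taken in \<open>E\<close> is one in \<open>S\<close>, so the same element is
  picked.\<close>

lemma star_idempotent_semigroup:
  assumes "e \<in> E"
  shows "star (idempotent_semigroup S) e = e"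
proof -
  have "(THE b. b \<in> E \<and> e \<cdot> b \<cdot> e = e \<and> b \<cdot> e \<cdot> b = b) = e"
    using assms star_unique[of e] star_idempotent[OF assms]
    by (intro the_equality) (simp_all add: idempotentsD, metis idempotent_closed)
  then show ?thesis
    by (simp add: star_def idempotent_semigroup_def)
qed

lemma nat_le_idempotent_semigroup: "e \<in> E \<Longrightarrow> nat_le (idempotent_semigroup S) e f \<longleftrightarrow> e \<preceq> f"
  by (simp add: nat_le_def star_idempotent_semigroup star_idempotent)
    (simp add: idempotent_semigroup_def)

text \<open>The two down sets range over different carriers; they agree because everything in
  \<open>S\<close> below an idempotent is idempotent.\<close>

lemma down_set_idempotent_semigroup: "e \<in> E \<Longrightarrow> down_set (idempotent_semigroup S) e = down_set S e"
  by (auto simp: down_set_def carrier_idempotent_semigroup nat_le_idempotent_semigroup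
      idempotent_closed le_idempotent)

section \<open>Proper filters in \<open>S\<close> and in \<open>E\<close>\<close>

lemma proper_filter_iff:
  "F \<in> proper_filters S \<longleftrightarrow> F \<subseteq> carrier S \<and> F \<noteq> {} \<and> \<zero> \<notin> F
    \<and> (\<forall>a\<in>F. \<forall>b\<in>carrier S. a \<preceq> b \<longrightarrow> b \<in> F) \<and> (\<forall>a\<in>F. \<forall>b\<in>F. \<exists>c\<in>F. c \<preceq> a \<and> c \<preceq> b)"
proof (cases "F \<subseteq> carrier S")
  case True
  \<comment> \<open>Reflexivity of the order yields one inclusion of the fixed-point equation, so
    only upward closedness remains.\<close>
  then have "up_closure S F = F \<longleftrightarrow> (\<forall>a\<in>F. \<forall>b\<in>carrier S. a \<preceq> b \<longrightarrow> b \<in> F)"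
    using le_refl unfolding up_closure_def by blast
  then show ?thesis
    unfolding proper_filters_def is_filter_def by auto
qed (auto simp: proper_filters_def is_filter_def)

text \<open>Expressing the filters of \<open>E\<close> through the order of \<open>S\<close> lets
  the order facts above serve for both semigroups.\<close>

lemma idempotent_proper_filter_iff:
  "\<xi> \<in> proper_filters (idempotent_semigroup S) \<longleftrightarrow> \<xi> \<subseteq> E \<and> \<xi> \<noteq> {} \<and> \<zero> \<notin> \<xi>
    \<and> (\<forall>a\<in>\<xi>. \<forall>b\<in>E. a \<preceq> b \<longrightarrow> b \<in> \<xi>) \<and> (\<forall>a\<in>\<xi>. \<forall>b\<in>\<xi>. \<exists>c\<in>\<xi>. c \<preceq> a \<and> c \<preceq> b)"
proof (cases "\<xi> \<subseteq> E")
  case True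
  then have "nat_le (idempotent_semigroup S) a b \<longleftrightarrow> a \<preceq> b" if "a \<in> \<xi>" for a b
    using that nat_le_idempotent_semigroup by blast
  moreover have "\<zero>\<^bsub>idempotent_semigroup S\<^esub> = \<zero>"
    by (simp add: idempotent_semigroup_def)
  ultimately show ?thesis
    unfolding proper_filters_def is_filter_def up_closure_def carrier_idempotent_semigroup
    using True le_refl idempotent_closed by auto blast+
qed (auto simp: proper_filters_def is_filter_def carrier_idempotent_semigroup)

lemma proper_filter_up:
  "\<lbrakk>F \<in> proper_filters S; a \<in> F; a \<preceq> b; b \<in> carrier S\<rbrakk> \<Longrightarrow> b \<in> F"
  by (auto simp: proper_filter_iff)

lemma proper_filter_directed:
  assumes "F \<in> proper_filters S" "a \<in> F" "b \<in> F"
  obtains c where "c \<in> F" "c \<preceq> a" "c \<preceq> b" "c \<in> carrier S"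
  using assms unfolding proper_filter_iff by blast

lemma idempotent_proper_filter_up:
  "\<lbrakk>\<xi> \<in> proper_filters (idempotent_semigroup S); a \<in> \<xi>; a \<preceq> b; b \<in> E\<rbrakk> \<Longrightarrow> b \<in> \<xi>"
  by (auto simp: idempotent_proper_filter_iff)

lemma idempotent_proper_filter_directed:
  assumes "\<xi> \<in> proper_filters (idempotent_semigroup S)" "a \<in> \<xi>" "b \<in> \<xi>"
  obtains c where "c \<in> \<xi>" "c \<preceq> a" "c \<preceq> b"
  using assms unfolding idempotent_proper_filter_iff by blast

section \<open>The bijection between idempotent filters of \<open>S\<close> and filters of
  \<open>E\<close>\<close>

lemma idempotent_part_proper_filter:
  assumes "F \<in> idempotent_proper_filters S"
  shows "F \<inter> E \<in> proper_filters (idempotent_semigroup S)"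
proof -
  have F: "F \<in> proper_filters S" and ne: "F \<inter> E \<noteq> {}"
    using assms by (auto simp: idempotent_proper_filters_def)
  have "\<exists>c\<in>F \<inter> E. c \<preceq> a \<and> c \<preceq> b" if ab: "a \<in> F \<inter> E" "b \<in> F \<inter> E" for a b
  proof -
    obtain c where "c \<in> F" "c \<preceq> a" "c \<preceq> b" "c \<in> carrier S"
      using proper_filter_directed[OF F, of a b] ab by blast
    then show ?thesis using le_idempotent ab by blast
  qed
  then show ?thesis
    using F ne idempotent_closed unfolding idempotent_proper_filter_iff proper_filter_iff
    by (intro conjI) blast+
qed

lemma up_closure_idempotent_part:
  assumes "F \<in> idempotent_proper_filters S"
  shows "up_closure S (F \<inter> E) = F"
proof -
  obtain e where F: "F \<in> proper_filters S" and e: "e \<in> F" "e \<in> E"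
    using assms by (auto simp: idempotent_proper_filters_def)
  have "b \<in> up_closure S (F \<inter> E)" if b: "b \<in> F" for b
  proof -
    obtain c where c: "c \<in> F" "c \<preceq> e" "c \<preceq> b" "c \<in> carrier S"
      using proper_filter_directed[OF F e(1) b] by blast
    moreover have "b \<in> carrier S" using F that by (auto simp: proper_filter_iff)
    ultimately show ?thesis
      using le_idempotent[OF c(2,4) e(2)] by (auto simp: up_closure_def)
  qed
  then show ?thesis
    using proper_filter_up[OF F] by (auto simp: up_closure_def)
qed

lemma subset_up_closure: "A \<subseteq> carrier S \<Longrightarrow> A \<subseteq> up_closure S A"
  using le_refl by (auto simp: up_closure_def)

lemma up_closure_mono: "A \<subseteq> B \<Longrightarrow> up_closure S A \<subseteq> up_closure S B"
  by (auto simp: up_closure_def)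

text \<open>Closing upward in \<open>S\<close> adds no new idempotents, since \<xi> is already
  upward closed among the idempotents.\<close>

lemma idempotent_part_up_closure:
  assumes "\<xi> \<in> proper_filters (idempotent_semigroup S)"
  shows "up_closure S \<xi> \<inter> E = \<xi>"
proof
  show "up_closure S \<xi> \<inter> E \<subseteq> \<xi>"
    using idempotent_proper_filter_up[OF assms] by (auto simp: up_closure_def)
  show "\<xi> \<subseteq> up_closure S \<xi> \<inter> E"
    using assms subset_up_closure[of \<xi>] idempotent_closed
    by (auto simp: idempotent_proper_filter_iff)
qed

text \<open>Lower bounds are found among the generators in \<xi>, and zero stays out because only
  zero lies below zero. The closure meets \<open>E\<close> because its idempotent part is \<xi>,
  which is nonempty.\<close>

lemma up_closure_proper_filter:
  assumes "\<xi> \<in> proper_filters (idempotent_semigroup S)"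
  shows "up_closure S \<xi> \<in> idempotent_proper_filters S"
proof -
  have \<xi>: "\<xi> \<subseteq> E" "\<xi> \<noteq> {}" "\<zero> \<notin> \<xi>" "\<And>a b. a \<in> \<xi> \<Longrightarrow> b \<in> \<xi> \<Longrightarrow> \<exists>c\<in>\<xi>. c \<preceq> a \<and> c \<preceq> b"
    using assms unfolding idempotent_proper_filter_iff by auto
  have \<xi>S: "a \<in> carrier S" if "a \<in> \<xi>" for a
    using \<xi>(1) idempotent_closed that by blast
  have "up_closure S \<xi> \<in> proper_filters S"
    unfolding proper_filter_iff
  proof (intro conjI ballI impI)
    show "up_closure S \<xi> \<subseteq> carrier S" by (auto simp: up_closure_def)
    show "up_closure S \<xi> \<noteq> {}"
      using \<xi>(2) \<xi>S le_refl by (auto simp: up_closure_def)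
    show "\<zero> \<notin> up_closure S \<xi>"
      using \<xi>(3) \<xi>S le_zero by (auto simp: up_closure_def)
  next
    fix a b assume "a \<in> up_closure S \<xi>" "b \<in> carrier S" "a \<preceq> b"
    then show "b \<in> up_closure S \<xi>"
      using le_trans \<xi>S unfolding up_closure_def by blast
  next
    fix a b assume "a \<in> up_closure S \<xi>" "b \<in> up_closure S \<xi>"
    then obtain a' b' where ab: "a \<in> carrier S" "b \<in> carrier S" "a' \<in> \<xi>" "b' \<in> \<xi>" "a' \<preceq> a" "b' \<preceq> b"
      by (auto simp: up_closure_def)
    then obtain c where c: "c \<in> \<xi>" "c \<preceq> a'" "c \<preceq> b'"
      using \<xi>(4) by blast
    then have "c \<preceq> a" "c \<preceq> b"
      using ab le_trans \<xi>S by blast+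
    then show "\<exists>c\<in>up_closure S \<xi>. c \<preceq> a \<and> c \<preceq> b"
      using c(1) subset_up_closure[of \<xi>] \<xi>S by blast
  qed
  then show ?thesis
    using idempotent_part_up_closure[OF assms] \<xi>(2) by (simp add: idempotent_proper_filters_def)
qed

section \<open>Ultrafilters under the bijection\<close>

lemma idempotent_ultrafilters_alt:
  "idempotent_ultrafilters S =
    {F \<in> idempotent_proper_filters S. F \<inter> E \<in> ultrafilters (idempotent_semigroup S)}"
  (is "?L = ?R")
proof (intro subset_antisym subsetI)
  fix F assume "F \<in> idempotent_ultrafilters S"
  then have F: "F \<in> idempotent_proper_filters S"
    and max: "\<And>G. G \<in> proper_filters S \<Longrightarrow> F \<subseteq> G \<Longrightarrow> G = F"
    by (auto simp: idempotent_ultrafilters_def ultrafilters_def idempotent_proper_filters_def)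
  \<comment> \<open>The closure of a larger \<xi> contains the closure of
    \<open>F \<inter> E\<close>, which is \<open>F\<close>. Maximality of \<open>F\<close> makes the
    closures equal, and intersecting with \<open>E\<close> returns \<xi>.\<close>
  have "\<xi> = F \<inter> E" if \<xi>: "\<xi> \<in> proper_filters (idempotent_semigroup S)" and "F \<inter> E \<subseteq> \<xi>" for \<xi>
  proof -
    have "up_closure S \<xi> = F"
      using max[of "up_closure S \<xi>"] up_closure_proper_filter[OF \<xi>] up_closure_idempotent_part[OF F]
        up_closure_mono[OF that(2)] by (simp add: idempotent_proper_filters_def)
    then show ?thesis using idempotent_part_up_closure[OF \<xi>] by simp
  qed
  then show "F \<in> ?R"
    using F idempotent_part_proper_filter[OF F] by (simp add: ultrafilters_def)
next
  fix F assume "F \<in> ?R"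
  then have F: "F \<in> idempotent_proper_filters S"
    and max: "\<And>\<xi>. \<xi> \<in> proper_filters (idempotent_semigroup S) \<Longrightarrow> F \<inter> E \<subseteq> \<xi> \<Longrightarrow> \<xi> = F \<inter> E"
    by (auto simp: ultrafilters_def)
  \<comment> \<open>Maximality has to be tested against all proper filters, but a filter containing
    \<open>F\<close> inherits an idempotent from it and so falls under the bijection.\<close>
  have "G = F" if "G \<in> proper_filters S" and "F \<subseteq> G" for G
  proof -
    have G: "G \<in> idempotent_proper_filters S"
      using that F by (auto simp: idempotent_proper_filters_def)
    then have "G \<inter> E = F \<inter> E"
      using max[OF idempotent_part_proper_filter[OF G]] that(2) by blast
    then show ?thesis
      using up_closure_idempotent_part[OF F] up_closure_idempotent_part[OF G] by simp
  qed
  then show "F \<in> idempotent_ultrafilters S"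
    using F by (simp add: idempotent_ultrafilters_def ultrafilters_def idempotent_proper_filters_def)
qed

section \<open>Patch topologies and continuity in both directions\<close>

lemma mem_up_closure_iff:
  assumes \<xi>: "\<xi> \<in> proper_filters (idempotent_semigroup S)"
    and e: "e \<in> \<xi>" "e \<preceq> s" and t: "t \<preceq> s" "t \<in> carrier S" "s \<in> carrier S"
  shows "t \<in> up_closure S \<xi> \<longleftrightarrow> e \<cdot> t \<in> \<xi>"
proof
  have eE: "e \<in> E" using \<xi> e by (auto simp: idempotent_proper_filter_iff)
  have etS: "e \<cdot> t \<in> carrier S" using eE t by (simp add: idempotent_closed mult_closed)
  show "t \<in> up_closure S \<xi>" if "e \<cdot> t \<in> \<xi>"
    using that idempotent_mult_le[OF eE t(2)] t(2) by (auto simp: up_closure_def)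
  assume "t \<in> up_closure S \<xi>"
  then obtain b where b: "b \<in> \<xi>" "b \<preceq> t" by (auto simp: up_closure_def)
  then obtain c where c: "c \<in> \<xi>" "c \<preceq> e" "c \<preceq> b"
    using idempotent_proper_filter_directed[OF \<xi> _ e(1)] by blast
  have E: "b \<in> E" "c \<in> E" using b c \<xi> by (auto simp: idempotent_proper_filter_iff)
  have ct: "c \<preceq> t" using le_trans[OF c(3) b(2)] E t by (simp add: idempotent_closed)
  \<comment> \<open>Since \<open>c\<close> lies below \<open>e\<close>, multiplying
    \<open>c \<preceq> t\<close> by \<open>e\<close> leaves the left side unchanged.\<close>
  have "e \<cdot> c = c"
    using idempotent_le_mult[OF E(2) c(2)] idempotents_commute[OF eE E(2)] by simp
  then have "c \<preceq> e \<cdot> t"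
    using idempotent_mult_mono[OF eE ct] E t by (simp add: idempotent_closed)
  \<comment> \<open>The element \<open>t\<close> need not be idempotent, but \<open>e t\<close> lies
    below \<open>e s = e\<close> and therefore is.\<close>
  moreover have "e \<cdot> t \<in> E"
    using idempotent_mult_mono[OF eE t] idempotent_le_mult[OF eE e(2)] le_idempotent[OF _ etS eE]
    by simp
  ultimately show "e \<cdot> t \<in> \<xi>"
    using idempotent_proper_filter_up[OF \<xi> c(1)] by blast
qed

text \<open>This makes the products \<open>e t\<close> admissible as forbidden elements of a basic
  patch at \<open>e\<close>; the reason is \<open>e t \<preceq> e s = e\<close>.\<close>

lemma mult_mem_down_set:
  assumes "e \<in> E" "e \<preceq> s" "t \<in> down_set S s" "s \<in> carrier S"
  shows "e \<cdot> t \<in> down_set S e"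
  using assms idempotent_mult_mono[of e t s] idempotent_le_mult[of e s]
  by (auto simp: down_set_def idempotent_closed mult_closed)

lemma openin_basic_patch_idempotent:
  assumes "e \<in> E" "finite X" "X \<subseteq> down_set S e"
  shows "openin (patch_topology (idempotent_semigroup S)) (basic_patch (idempotent_semigroup S) e X)"
  unfolding patch_topology_def
  using assms down_set_idempotent_semigroup
  by (intro topology_generated_by_Basis) (unfold carrier_idempotent_semigroup, blast)

lemma openin_basic_patch:
  assumes "s \<in> carrier S" "finite T" "T \<subseteq> down_set S s"
  shows "openin (patch_topology S) (basic_patch S s T)"
  unfolding patch_topology_def using assms by (intro topology_generated_by_Basis) auto

lemma idempotent_proper_filters_subset: "idempotent_proper_filters S \<subseteq> proper_filters S"
  by (auto simp: idempotent_proper_filters_def)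

text \<open>The preimage of a basic patch of \<open>E\<close> is cut out by the patch of
  \<open>S\<close> with the same data \<open>e\<close>, \<open>X\<close>: as \<open>X\<close>
  consists of idempotents, \<open>F\<close> avoids \<open>X\<close> exactly when
  \<open>F \<inter> E\<close> does.\<close>

lemma continuous_map_idempotent_part:
  "continuous_map (subtopology (patch_topology S) (idempotent_proper_filters S))
     (patch_topology (idempotent_semigroup S)) (\<lambda>F. F \<inter> E)"
  unfolding patch_topology_def[of "idempotent_semigroup S"]
proof (rule continuous_on_generated_topo, goal_cases)
  case (1 U)
  then obtain e X where U: "U = basic_patch (idempotent_semigroup S) e X"
    and e: "e \<in> E" "finite X" "X \<subseteq> down_set S e"
    by (auto simp: carrier_idempotent_semigroup down_set_idempotent_semigroup)
  have "X \<subseteq> E" using e by (auto simp: down_set_def le_idempotent)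
  then have "(\<lambda>F. F \<inter> E) -` U \<inter> idempotent_proper_filters S
      = basic_patch S e X \<inter> idempotent_proper_filters S"
    using e(1) idempotent_part_proper_filter
    by (auto simp: U basic_patch_def carrier_idempotent_semigroup idempotent_proper_filters_def
        proper_filter_iff)
  then show ?case
    using openin_basic_patch[of e X] e idempotent_proper_filters_subset
    by (auto simp: openin_subtopology topspace_patch_topology idempotent_closed Int_absorb1)
next
  \<comment> \<open>The image must lie in the union of the generating sets; unfolding the
    computation of \<open>topspace\<close> identifies that union with the proper filters of
    \<open>E\<close>.\<close>
  case 2
  then show ?case
    using idempotent_part_proper_filter
      topspace_patch_topology[of "idempotent_semigroup S",
        unfolded patch_topology_def topology_generated_by_topspace]
    by (simp add: topspace_patch_topology image_subset_iff)
qed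

lemma continuous_map_up_closure:
  "continuous_map (patch_topology (idempotent_semigroup S))
     (subtopology (patch_topology S) (idempotent_proper_filters S)) (up_closure S)"
  unfolding continuous_map_in_subtopology
proof
  show "up_closure S \<in> topspace (patch_topology (idempotent_semigroup S)) \<rightarrow> idempotent_proper_filters S"
    by (simp add: topspace_patch_topology up_closure_proper_filter)
  show "continuous_map (patch_topology (idempotent_semigroup S)) (patch_topology S) (up_closure S)"
    unfolding patch_topology_def[of S]
  proof (rule continuous_on_generated_topo, goal_cases)
    case (1 U)
    then obtain s T where U: "U = basic_patch S s T"
      and s: "s \<in> carrier S" "finite T" "T \<subseteq> down_set S s" by auto
    let ?P = "proper_filters (idempotent_semigroup S)"
    have "\<exists>V. openin (patch_topology (idempotent_semigroup S)) V \<and> \<xi> \<in> V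
            \<and> V \<subseteq> up_closure S -` U \<inter> ?P"
      if \<xi>: "\<xi> \<in> up_closure S -` U \<inter> ?P" for \<xi>
    proof -
      \<comment> \<open>The idempotent \<open>e\<close> depends on \<xi>, so openness of the
        preimage is shown locally. It exists because \<open>s\<close> lies in the upward closure of
        \<xi>.\<close>
      obtain e where e: "e \<in> \<xi>" "e \<preceq> s"
        using \<xi> by (auto simp: U basic_patch_def up_closure_def)
      then have eE: "e \<in> E" using \<xi> by (auto simp: idempotent_proper_filter_iff)
      let ?V = "basic_patch (idempotent_semigroup S) e ((\<lambda>t. e \<cdot> t) ` T)"
      \<comment> \<open>Among filters containing \<open>e\<close>, the neighbourhood and the
        preimage coincide: \<open>s\<close> is in the closure automatically, and avoiding
        \<open>t\<close> means avoiding \<open>e t\<close>. All members of \<open>?V\<close> contain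
        \<open>e\<close>, so \<open>?V\<close> lies inside the preimage.\<close>
      have eq: "\<eta> \<in> ?V \<longleftrightarrow> \<eta> \<in> up_closure S -` U \<inter> ?P" if "e \<in> \<eta>" and \<eta>: "\<eta> \<in> ?P" for \<eta>
      proof -
        have "t \<in> up_closure S \<eta> \<longleftrightarrow> e \<cdot> t \<in> \<eta>" if "t \<in> T" for t
          using mem_up_closure_iff[OF \<eta> \<open>e \<in> \<eta>\<close> e(2)] that s by (auto simp: down_set_def)
        moreover have "s \<in> up_closure S \<eta>"
          using that e s by (auto simp: up_closure_def)
        moreover have "up_closure S \<eta> \<in> proper_filters S" "up_closure S \<eta> \<subseteq> carrier S"
          using up_closure_proper_filter[OF \<eta>]
          by (auto simp: idempotent_proper_filters_def up_closure_def)
        moreover have "\<eta> \<subseteq> E" using \<eta> by (simp add: idempotent_proper_filter_iff)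
        ultimately show ?thesis
          using that by (auto simp: U basic_patch_def carrier_idempotent_semigroup)
      qed
      have "openin (patch_topology (idempotent_semigroup S)) ?V"
        using mult_mem_down_set[OF eE e(2)] s
        by (intro openin_basic_patch_idempotent) (auto simp: eE)
      moreover have "\<xi> \<in> ?V" using eq e \<xi> by blast
      moreover have "?V \<subseteq> up_closure S -` U \<inter> ?P"
        using eq by (auto simp: basic_patch_def)
      ultimately show ?thesis by blast
    qed
    then show ?case
      by (subst openin_subopen) (simp add: topspace_patch_topology)
  next
    case 2
    then show ?case
      using up_closure_proper_filter idempotent_proper_filters_subset
        topspace_patch_topology[of S, unfolded patch_topology_def topology_generated_by_topspace]
      by (auto simp: topspace_patch_topology image_subset_iff)
  qed
qed

lemma homeomorphic_maps_idempotent_part: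
  "homeomorphic_maps (subtopology (patch_topology S) (idempotent_proper_filters S))
     (patch_topology (idempotent_semigroup S)) (\<lambda>F. F \<inter> E) (up_closure S)"
  using continuous_map_idempotent_part continuous_map_up_closure
  by (auto simp: homeomorphic_maps_def topspace_patch_topology up_closure_idempotent_part
      idempotent_part_up_closure)

section \<open>The Hausdorff property\<close>

lemma Hausdorff_patch_idempotent_semigroup:
  "Hausdorff_space (patch_topology (idempotent_semigroup S))"
proof -
  let ?P = "patch_topology (idempotent_semigroup S)"
  have sep: "\<exists>U V. openin ?P U \<and> openin ?P V \<and> \<xi> \<in> U \<and> \<eta> \<in> V \<and> disjnt U V"
    if \<xi>: "\<xi> \<in> proper_filters (idempotent_semigroup S)"
      and \<eta>: "\<eta> \<in> proper_filters (idempotent_semigroup S)"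
      and e: "e \<in> \<xi>" "e \<notin> \<eta>" for \<xi> \<eta> e
  proof -
    \<comment> \<open>A patch may forbid only elements below the one it requires, so
      \<open>e\<close> cannot simply be forbidden. Any \<open>f\<close> in \<eta> serves as the
      required element, with \<open>e f\<close> forbidden in place of \<open>e\<close>.\<close>
    obtain f where f: "f \<in> \<eta>" using \<eta> by (auto simp: idempotent_proper_filter_iff)
    have E: "e \<in> E" "f \<in> E" "\<xi> \<subseteq> E" "\<eta> \<subseteq> E"
      using \<xi> \<eta> e f by (auto simp: idempotent_proper_filter_iff)
    have ef: "e \<cdot> f \<in> E" "e \<cdot> f \<preceq> f" "e \<cdot> f \<preceq> e"
      using E idempotents_mult_closed idempotent_mult_le[of e f] idempotent_mult_le[of f e]
        idempotents_commute[of e f] by (auto simp: idempotent_closed)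
    have "e \<cdot> f \<notin> \<eta>"
      using idempotent_proper_filter_up[OF \<eta> _ ef(3) E(1)] e(2) by blast
    \<comment> \<open>Filters of \<open>E\<close> are closed under products, so no filter contains
      \<open>e\<close> and \<open>f\<close> yet avoids \<open>e f\<close>. This gives disjointness
      of the two patches.\<close>
    moreover have "e \<cdot> f \<in> \<zeta>"
      if \<zeta>: "\<zeta> \<in> proper_filters (idempotent_semigroup S)" and ef\<zeta>: "e \<in> \<zeta>" "f \<in> \<zeta>" for \<zeta>
    proof -
      obtain c where c: "c \<in> \<zeta>" "c \<preceq> e" "c \<preceq> f"
        using idempotent_proper_filter_directed[OF \<zeta> ef\<zeta>] by blast
      then have cE: "c \<in> E" using \<zeta> by (auto simp: idempotent_proper_filter_iff)
      have "e \<cdot> c = c"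
        using idempotent_le_mult[OF cE c(2)] idempotents_commute[OF E(1) cE] by simp
      then have "c \<preceq> e \<cdot> f"
        using idempotent_mult_mono[OF E(1) c(3)] E(2) cE by (simp add: idempotent_closed)
      then show ?thesis using idempotent_proper_filter_up[OF \<zeta> c(1)] ef(1) by blast
    qed
    ultimately have "\<xi> \<in> basic_patch (idempotent_semigroup S) e {}"
      "\<eta> \<in> basic_patch (idempotent_semigroup S) f {e \<cdot> f}"
      "disjnt (basic_patch (idempotent_semigroup S) e {})
         (basic_patch (idempotent_semigroup S) f {e \<cdot> f})"
      using E e f \<xi> \<eta>
      unfolding basic_patch_def carrier_idempotent_semigroup disjnt_def by blast+
    moreover have "openin ?P (basic_patch (idempotent_semigroup S) e {})"
      "openin ?P (basic_patch (idempotent_semigroup S) f {e \<cdot> f})"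
      using E ef by (auto intro!: openin_basic_patch_idempotent simp: down_set_def idempotent_closed)
    ultimately show ?thesis by blast
  qed
  show ?thesis
    unfolding Hausdorff_space_def topspace_patch_topology
  proof (intro allI impI, elim conjE)
    fix \<xi> \<eta>
    assume P: "\<xi> \<in> proper_filters (idempotent_semigroup S)"
      "\<eta> \<in> proper_filters (idempotent_semigroup S)" and "\<xi> \<noteq> \<eta>"
    then consider e where "e \<in> \<xi>" "e \<notin> \<eta>" | e where "e \<in> \<eta>" "e \<notin> \<xi>" by blast
    then show "\<exists>U V. openin ?P U \<and> openin ?P V \<and> \<xi> \<in> U \<and> \<eta> \<in> V \<and> disjnt U V"
    proof cases
      case 1
      then show ?thesis using sep[OF P] by blast
    next
      case 2
      then obtain U V where "openin ?P U" "openin ?P V" "\<eta> \<in> U" "\<xi> \<in> V" "disjnt U V"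
        using sep[OF P(2,1)] by blast
      then show ?thesis using disjnt_sym[of U V] by blast
    qed
  qed
qed

end

section \<open>The homeomorphism and its restriction to ultrafilters\<close>

theorem proposition2p2:
  fixes S :: "('a, 'm) semigroup_zero_scheme"
    and \<epsilon> :: "'a set \<Rightarrow> 'a set"
  assumes "inverse_semigroup_zero S"
  defines "\<epsilon> \<equiv> \<lambda>F. F \<inter> idempotents S"
  shows "bij_betw \<epsilon> (idempotent_proper_filters S) (proper_filters (idempotent_semigroup S))
    \<and> (\<forall>\<xi>\<in>proper_filters (idempotent_semigroup S).
          inv_into (idempotent_proper_filters S) \<epsilon> \<xi> = up_closure S \<xi>)
    \<and> Hausdorff_space (subtopology (patch_topology S) (idempotent_proper_filters S))
    \<and> Hausdorff_space (patch_topology (idempotent_semigroup S))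
    \<and> homeomorphic_map
          (subtopology (patch_topology S) (idempotent_proper_filters S))
          (patch_topology (idempotent_semigroup S)) \<epsilon>
    \<and> homeomorphic_map
          (subtopology (patch_topology S) (idempotent_ultrafilters S))
          (subtopology (patch_topology (idempotent_semigroup S))
             (ultrafilters (idempotent_semigroup S))) \<epsilon>"
proof -
  interpret inverse_semigroup_zero S by fact
  let ?I = "idempotent_semigroup S"
  let ?X = "subtopology (patch_topology S) (idempotent_proper_filters S)"
  have bij: "bij_betw \<epsilon> (idempotent_proper_filters S) (proper_filters ?I)"
    unfolding \<epsilon>_def
    by (rule bij_betw_byWitness[where f' = "up_closure S"])
      (simp_all add: up_closure_idempotent_part idempotent_part_up_closure
        idempotent_part_proper_filter up_closure_proper_filter image_subset_iff)
  have inv: "inv_into (idempotent_proper_filters S) \<epsilon> \<xi> = up_closure S \<xi>"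
    if "\<xi> \<in> proper_filters ?I" for \<xi>
    using bij that by (intro inv_into_f_eq)
      (auto simp: bij_betw_def \<epsilon>_def up_closure_proper_filter idempotent_part_up_closure)
  have hom: "homeomorphic_map ?X (patch_topology ?I) \<epsilon>"
    using homeomorphic_maps_idempotent_part unfolding \<epsilon>_def homeomorphic_map_maps by blast
  \<comment> \<open>Separation is proved directly only on the side of \<open>E\<close> and carried
    back along the homeomorphism.\<close>
  then have "Hausdorff_space ?X"
    using Hausdorff_patch_idempotent_semigroup homeomorphic_Hausdorff_space
      homeomorphic_map_imp_homeomorphic_space by blast
  moreover have "homeomorphic_map (subtopology (patch_topology S) (idempotent_ultrafilters S))
      (subtopology (patch_topology ?I) (ultrafilters ?I)) \<epsilon>"
  proof -
    \<comment> \<open>Restricting \<open>hom\<close> produces a subspace of a subspace; this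
      identity flattens it to a subspace of the patch topology on all proper filters.\<close>
    have U: "idempotent_proper_filters S \<inter> idempotent_ultrafilters S = idempotent_ultrafilters S"
      by (auto simp: idempotent_ultrafilters_alt)
    \<comment> \<open>Read as a preimage under \<epsilon>, this set has image exactly the
      ultrafilters of \<open>E\<close>, because \<epsilon> is onto the proper filters. That image
      equation is what restricting a homeomorphism to subspaces requires.\<close>
    have alt: "idempotent_ultrafilters S
        = {F \<in> idempotent_proper_filters S. \<epsilon> F \<in> ultrafilters ?I}"
      by (simp add: idempotent_ultrafilters_alt \<epsilon>_def)
    have sub: "ultrafilters ?I \<subseteq> proper_filters ?I" by (auto simp: ultrafilters_def)
    have "\<epsilon> ` idempotent_ultrafilters S = ultrafilters ?I"
    proof
      show "ultrafilters ?I \<subseteq> \<epsilon> ` idempotent_ultrafilters S"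
      proof
        fix \<xi> assume \<xi>: "\<xi> \<in> ultrafilters ?I"
        then have "\<xi> \<in> \<epsilon> ` idempotent_proper_filters S"
          using bij_betw_imp_surj_on[OF bij] sub by blast
        with \<xi> show "\<xi> \<in> \<epsilon> ` idempotent_ultrafilters S"
          unfolding alt by (elim imageE) (intro image_eqI, assumption, simp)
      qed
    qed (simp add: alt image_subset_iff)
    moreover have "topspace ?X \<inter> idempotent_ultrafilters S = idempotent_ultrafilters S"
      using U idempotent_proper_filters_subset
      by (simp add: topspace_patch_topology Int_absorb1)
    ultimately have "\<epsilon> ` (topspace ?X \<inter> idempotent_ultrafilters S)
        = topspace (patch_topology ?I) \<inter> ultrafilters ?I"
      by (simp only: topspace_patch_topology Int_absorb1[OF sub])
    from homeomorphic_map_subtopologies[OF hom this] show ?thesis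
      by (simp add: subtopology_subtopology U)
  qed
  ultimately show ?thesis
    using bij inv hom Hausdorff_patch_idempotent_semigroup by blast
qed

end
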